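(* Let $k\ge 0$ be an integer and let $\mathbf{B}_h=(B_x^h,B_y^h)$ be a solution of the semi-discrete (continuous in time) DG scheme (F1)-(F2)-(C1)-(C2) described in the context, on a two-dimensional Cartesian mesh, with source term $\mathbf{M}=(M_x,M_y)$ and numerical source $\hat{\mathbf{M}}=(\hat M_x,\hat M_y)$ on the faces. (i) If $\mathbf{M}=0$, the scheme preserves the divergence of $\mathbf{B}_h$: in every cell $C$ of the mesh, $\frac{\partial}{\partial t}\,\mathrm{div}(\mathbf{B}_h)\equiv 0$. (ii) If $\mathbf{M}\neq 0$, the divergence evolves consistently with the equation $\frac{\partial}{\partial t}(\nabla\cdot\mathbf{B})+\nabla\cdot\mathbf{M}=0$, in the sense that on every cell $C$ the numerical solution satisfies $$\int_C \phi\,\frac{\partial}{\partial t}\mathrm{div}(\mathbf{B}_h)\,dx\,dy-\int_C \mathbf{M}\cdot\nabla\phi\,dx\,dy+\int_{\partial C}\phi\,\hat{\mathbf{M}}\cdot\mathbf{n}\,ds=0\qquad\text{for all }\phi\in Q_{k,k}(x,y),$$ where $\mathbf{n}$ is the outward unit normal to $\partial C$.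
   Context: **Model equation.** In two space dimensions consider $\frac{\partial B_x}{\partial t}+\frac{\partial E}{\partial y}=-M_x$, $\frac{\partial B_y}{\partial t}-\frac{\partial E}{\partial x}=-M_y$, where $E$ is the scalar electric field (for the induction equation $E=v_yB_x-v_xB_y$ with a given velocity field $(v_x,v_y)$) and $\mathbf{M}=(M_x,M_y)$ is a source term. Solutions satisfy $\frac{\partial}{\partial t}(\nabla\cdot\mathbf{B})+\nabla\cdot\mathbf{M}=0$. **Polynomial spaces.** $P_k(x)$, $P_k(y)$ are the one-variable polynomials of degree at most $k$ in $x$, respectively $y$. $Q_{r,s}(x,y)=\mathrm{span}\{x^iy^j:0\le i\le r,\ 0\le j\le s\}$. Set $\partial_xQ_{k,k}(x,y):=Q_{k-1,k}(x,y)$ and $\partial_yQ_{k,k}(x,y):=Q_{k,k-1}(x,y)$ (both are $\{0\}$ when $k=0$). The Raviart-Thomas space is $RT_k=Q_{k+1,k}\times Q_{k,k+1}$. **Mesh and unknown.** The mesh consists of axis-parallel rectangular cells $C$. Each cell has a left face $e_x^-$ and a right face $e_x^+$ (vertical), a bottom face $e_y^-$ and a top face $e_y^+$ (horizontal), and vertices numbered $0$ (bottom-left), $1$ (bottom-right), $2$ (top-left), $3$ (top-right). At each time $t$, $\mathbf{B}_h=(B_x^h,B_y^h)$ restricted to each cell belongs to $RT_k$, with normal component continuous across faces ($B_x^h$ across vertical faces, $B_y^h$ across horizontal faces); it depends differentiably on $t$. Here $E$ inside a cell denotes the electric field evaluated from $\mathbf{B}_h$ in that cell. **Numerical fluxes.**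 $\hat E$ is a numerical flux (from a 1-D Riemann solver), single-valued on each face of the mesh; $\tilde E$ is a numerical flux (from a multi-dimensional Riemann solver), with a unique value at each vertex of the mesh. The same $\hat E$ is used in the face equations and in the cell equations. $\hat M_x$ (on vertical faces) and $\hat M_y$ (on horizontal faces) are single-valued consistent numerical approximations of $M_x$, $M_y$; by consistency, $\hat{\mathbf{M}}=0$ when $\mathbf{M}=0$. On $\partial C$, $\hat{\mathbf{M}}\cdot\mathbf{n}$ equals $\hat M_xn_x$ on vertical faces and $\hat M_yn_y$ on horizontal faces. All these quantities, and $E$ and $\mathbf{M}$, are such that the integrals below are defined; integrals are taken exactly. **DG scheme.** For every cell $C$, with outward unit normal $\mathbf{n}=(n_x,n_y)$ on $\partial C$: (F1) on each vertical face $e=e_x^\pm$, for all $\phi\in P_k(y)$: $$\int_{e}\frac{\partial B_x^h}{\partial t}\phi\,dy-\int_{e}\hat E\,\frac{\partial\phi}{\partial y}\,dy+[\tilde E\phi]_{e}=-\int_{e}\hat M_x\phi\,dy;$$ (F2) on each horizontal face $e=e_y^\pm$, for all $\phi\in P_k(x)$: $$\int_{e}\frac{\partial B_y^h}{\partial t}\phi\,dx+\int_{e}\hat E\,\frac{\partial\phi}{\partial x}\,dx-[\tilde E\phi]_{e}=-\int_{e}\hat M_y\phi\,dx;$$ (C1) for all $\psi\in\partial_xQ_{k,k}(x,y)$: $$\int_C\frac{\partial B_x^h}{\partial t}\psi\,dx\,dy-\int_CE\,\frac{\partial\psi}{\partial y}\,dx\,dy+\int_{\partial C}\hat E\,\psi\,n_y\,ds=-\int_CM_x\psi\,dx\,dy;$$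 (C2) for all $\psi\in\partial_yQ_{k,k}(x,y)$: $$\int_C\frac{\partial B_y^h}{\partial t}\psi\,dx\,dy+\int_CE\,\frac{\partial\psi}{\partial x}\,dx\,dy-\int_{\partial C}\hat E\,\psi\,n_x\,ds=-\int_CM_y\psi\,dx\,dy.$$ The face difference operators are $$[\tilde E\phi]_{e_x^-}=(\tilde E\phi)_2-(\tilde E\phi)_0,\quad[\tilde E\phi]_{e_x^+}=(\tilde E\phi)_3-(\tilde E\phi)_1,\quad[\tilde E\phi]_{e_y^-}=(\tilde E\phi)_1-(\tilde E\phi)_0,\quad[\tilde E\phi]_{e_y^+}=(\tilde E\phi)_3-(\tilde E\phi)_2,$$ where $(\cdot)_i$ denotes the value at vertex $i$ of $C$. *)

theory Defs
  imports "HOL-Analysis.Analysis"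
begin

type_synonym point = "real \<times> real"
type_synonym cell = "int \<times> int"
type_synonym vertex = "int \<times> int"

text \<open>
  Cell \<open>(i, j)\<close> is \<open>[x i, x (i+1)] \<times> [y j, y (j+1)]\<close> and vertex \<open>(i, j)\<close> is the
  point \<open>(x i, y j)\<close>. Only the cells in \<open>cells\<close> belong to the mesh, so finite meshes are
  covered by extending the node sequences arbitrarily.
\<close>
record mesh =
  xnode :: "int \<Rightarrow> real"
  ynode :: "int \<Rightarrow> real"
  cells :: "cell set"

definition cartesian_mesh :: "mesh \<Rightarrow> bool" where
  "cartesian_mesh m \<longleftrightarrow> strict_mono (xnode m) \<and> strict_mono (ynode m)"

definition cell_set :: "mesh \<Rightarrow> cell \<Rightarrow> point set" where
  "cell_set m = (\<lambda>(i, j).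
     {xnode m i..xnode m (i + 1)} \<times> {ynode m j..ynode m (j + 1)})"

text \<open>
  \<open>VFace i j\<close> joins vertex \<open>(i, j)\<close> to \<open>(i, j+1)\<close>, and \<open>HFace i j\<close> joins vertex
  \<open>(i, j)\<close> to \<open>(i+1, j)\<close>. A quantity indexed by faces (vertices) is thereby
  single-valued on each face (vertex) of the mesh, whichever cell it is seen from.
\<close>
datatype face = VFace int int | HFace int int

definition cell_faces :: "cell \<Rightarrow> face set" where
  "cell_faces = (\<lambda>(i, j). {VFace i j, VFace (i + 1) j, HFace i j, HFace i (j + 1)})"

definition face_set :: "mesh \<Rightarrow> face \<Rightarrow> point set" where
  "face_set m e = (case e of
     VFace i j \<Rightarrow> {xnode m i} \<times> {ynode m j..ynode m (j + 1)}
   | HFace i j \<Rightarrow> {xnode m i..xnode m (i + 1)} \<times> {ynode m j})"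

text \<open>Meaningful only for \<open>e \<in> cell_faces C\<close>.\<close>
definition normal :: "cell \<Rightarrow> face \<Rightarrow> point" where
  "normal C e = (case e of
     VFace a b \<Rightarrow> if a = fst C then (-1, 0) else (1, 0)
   | HFace a b \<Rightarrow> if b = snd C then (0, -1) else (0, 1))"

definition cell_integral :: "mesh \<Rightarrow> cell \<Rightarrow> (point \<Rightarrow> real) \<Rightarrow> real" where
  "cell_integral m C g = integral (cell_set m C) g"

definition face_integral :: "mesh \<Rightarrow> face \<Rightarrow> (point \<Rightarrow> real) \<Rightarrow> real" where
  "face_integral m e g = (case e of
     VFace i j \<Rightarrow> integral {ynode m j..ynode m (j + 1)} (\<lambda>y. g (xnode m i, y))
   | HFace i j \<Rightarrow> integral {xnode m i..xnode m (i + 1)} (\<lambda>x. g (x, ynode m j)))"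

definition face_integrable :: "mesh \<Rightarrow> face \<Rightarrow> (point \<Rightarrow> real) \<Rightarrow> bool" where
  "face_integrable m e g = (case e of
     VFace i j \<Rightarrow> (\<lambda>y. g (xnode m i, y)) integrable_on {ynode m j..ynode m (j + 1)}
   | HFace i j \<Rightarrow> (\<lambda>x. g (x, ynode m j)) integrable_on {xnode m i..xnode m (i + 1)})"

definition boundary_integral :: "mesh \<Rightarrow> cell \<Rightarrow> (face \<Rightarrow> point \<Rightarrow> real) \<Rightarrow> real" where
  "boundary_integral m C g = (\<Sum>e\<in>cell_faces C. face_integral m e (g e))"

definition face_diff :: "face \<Rightarrow> (vertex \<Rightarrow> real) \<Rightarrow> real" where
  "face_diff e g = (case e of
     VFace i j \<Rightarrow> g (i, j + 1) - g (i, j)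
   | HFace i j \<Rightarrow> g (i + 1, j) - g (i, j))"

definition dx :: "(point \<Rightarrow> real) \<Rightarrow> point \<Rightarrow> real" where
  "dx f p = deriv (\<lambda>\<xi>. f (\<xi>, snd p)) (fst p)"

definition dy :: "(point \<Rightarrow> real) \<Rightarrow> point \<Rightarrow> real" where
  "dy f p = deriv (\<lambda>\<eta>. f (fst p, \<eta>)) (snd p)"

definition grad :: "(point \<Rightarrow> real) \<Rightarrow> point \<Rightarrow> point" where
  "grad f p = (dx f p, dy f p)"

definition divergence :: "(point \<Rightarrow> point) \<Rightarrow> point \<Rightarrow> real" where
  "divergence F p = dx (\<lambda>q. fst (F q)) p + dy (\<lambda>q. snd (F q)) p"

text \<open>Time derivative; one-sided at an end point belonging to the time interval \<open>T\<close>.\<close>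
definition ddt :: "real set \<Rightarrow> (real \<Rightarrow> real) \<Rightarrow> real \<Rightarrow> real" where
  "ddt T f t = vector_derivative f (at t within T)"

definition P_space :: "nat \<Rightarrow> (real \<Rightarrow> real) set" where
  "P_space k = {poly p |p. degree p \<le> k}"

definition Q_space :: "nat \<Rightarrow> nat \<Rightarrow> (point \<Rightarrow> real) set" where
  "Q_space r s =
     {f. \<exists>c :: nat \<Rightarrow> nat \<Rightarrow> real. f = (\<lambda>(x, y). \<Sum>i\<le>r. \<Sum>j\<le>s. c i j * x ^ i * y ^ j)}"

definition dxQ_space :: "nat \<Rightarrow> (point \<Rightarrow> real) set" where
  "dxQ_space k = (if k = 0 then {\<lambda>p. 0} else Q_space (k - 1) k)"

definition dyQ_space :: "nat \<Rightarrow> (point \<Rightarrow> real) set" where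
  "dyQ_space k = (if k = 0 then {\<lambda>p. 0} else Q_space k (k - 1))"

definition RT_space :: "nat \<Rightarrow> (point \<Rightarrow> point) set" where
  "RT_space k =
     {F. (\<lambda>p. fst (F p)) \<in> Q_space (k + 1) k \<and> (\<lambda>p. snd (F p)) \<in> Q_space k (k + 1)}"

text \<open>
  \<open>B t C\<close> is the polynomial field representing the discrete solution on the cell \<open>C\<close> at
  time \<open>t\<close>; different cells carry different polynomials, because tangential components may
  jump across faces. Being a polynomial, \<open>B t C\<close> is defined on the whole plane, so spatial
  derivatives at points of the cell boundary are those of the polynomial.
\<close>
type_synonym cell_field = "real \<Rightarrow> cell \<Rightarrow> point \<Rightarrow> point"
type_synonym face_field = "real \<Rightarrow> face \<Rightarrow> point \<Rightarrow> real"
type_synonym face_vector_field = "real \<Rightarrow> face \<Rightarrow> point \<Rightarrow> point"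
type_synonym vertex_field = "real \<Rightarrow> vertex \<Rightarrow> real"

definition normal_continuous :: "mesh \<Rightarrow> (cell \<Rightarrow> point \<Rightarrow> point) \<Rightarrow> bool" where
  "normal_continuous m F \<longleftrightarrow>
     (\<forall>i j. (i - 1, j) \<in> cells m \<and> (i, j) \<in> cells m \<longrightarrow>
        (\<forall>p\<in>face_set m (VFace i j). fst (F (i - 1, j) p) = fst (F (i, j) p))) \<and>
     (\<forall>i j. (i, j - 1) \<in> cells m \<and> (i, j) \<in> cells m \<longrightarrow>
        (\<forall>p\<in>face_set m (HFace i j). snd (F (i, j - 1) p) = snd (F (i, j) p)))"

definition admissible_unknown :: "mesh \<Rightarrow> real set \<Rightarrow> nat \<Rightarrow> cell_field \<Rightarrow> bool" where
  "admissible_unknown m T k B \<longleftrightarrow>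
     (\<forall>t\<in>T. \<forall>C\<in>cells m. B t C \<in> RT_space k) \<and>
     (\<forall>t\<in>T. normal_continuous m (B t)) \<and>
     (\<forall>t\<in>T. \<forall>C\<in>cells m. \<forall>p\<in>cell_set m C.
        (\<lambda>s. B s C p) differentiable (at t within T))"

text \<open>
  In the equations below, \<open>E t C p b\<close> is the electric field at time \<open>t\<close> and point \<open>p\<close> of
  the cell \<open>C\<close> for the magnetic field value \<open>b\<close>; for the induction equation with velocity
  \<open>v\<close> it is \<open>snd (v t p) * fst b - fst (v t p) * snd b\<close>. \<open>Eh\<close> and \<open>Ev\<close> are the numerical
  fluxes at faces and at vertices. Of \<open>Mh\<close>, only the x-component on vertical faces and the
  y-component on horizontal faces are used; the inner product with the normal discards the
  other component.
\<close>

definition scheme_F1 ::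
  "mesh \<Rightarrow> real set \<Rightarrow> nat \<Rightarrow> face_field \<Rightarrow> vertex_field \<Rightarrow> face_vector_field \<Rightarrow> cell_field \<Rightarrow> bool"
where
  "scheme_F1 m T k Eh Ev Mh B \<longleftrightarrow>
     (\<forall>t\<in>T. \<forall>(i, j)\<in>cells m. \<forall>e\<in>{VFace i j, VFace (i + 1) j}. \<forall>\<phi>\<in>P_space k.
        face_integral m e (\<lambda>p. ddt T (\<lambda>s. fst (B s (i, j) p)) t * \<phi> (snd p))
        - face_integral m e (\<lambda>p. Eh t e p * deriv \<phi> (snd p))
        + face_diff e (\<lambda>v. Ev t v * \<phi> (ynode m (snd v)))
        = - face_integral m e (\<lambda>p. fst (Mh t e p) * \<phi> (snd p)))"

definition scheme_F2 ::
  "mesh \<Rightarrow> real set \<Rightarrow> nat \<Rightarrow> face_field \<Rightarrow> vertex_field \<Rightarrow> face_vector_field \<Rightarrow> cell_field \<Rightarrow> bool"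
where
  "scheme_F2 m T k Eh Ev Mh B \<longleftrightarrow>
     (\<forall>t\<in>T. \<forall>(i, j)\<in>cells m. \<forall>e\<in>{HFace i j, HFace i (j + 1)}. \<forall>\<phi>\<in>P_space k.
        face_integral m e (\<lambda>p. ddt T (\<lambda>s. snd (B s (i, j) p)) t * \<phi> (fst p))
        + face_integral m e (\<lambda>p. Eh t e p * deriv \<phi> (fst p))
        - face_diff e (\<lambda>v. Ev t v * \<phi> (xnode m (fst v)))
        = - face_integral m e (\<lambda>p. snd (Mh t e p) * \<phi> (fst p)))"

definition scheme_C1 ::
  "mesh \<Rightarrow> real set \<Rightarrow> nat \<Rightarrow> (real \<Rightarrow> cell \<Rightarrow> point \<Rightarrow> point \<Rightarrow> real) \<Rightarrow> face_field \<Rightarrow>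
   cell_field \<Rightarrow> cell_field \<Rightarrow> bool"
where
  "scheme_C1 m T k E Eh M B \<longleftrightarrow>
     (\<forall>t\<in>T. \<forall>C\<in>cells m. \<forall>\<psi>\<in>dxQ_space k.
        cell_integral m C (\<lambda>p. ddt T (\<lambda>s. fst (B s C p)) t * \<psi> p)
        - cell_integral m C (\<lambda>p. E t C p (B t C p) * dy \<psi> p)
        + boundary_integral m C (\<lambda>e p. Eh t e p * \<psi> p * snd (normal C e))
        = - cell_integral m C (\<lambda>p. fst (M t C p) * \<psi> p))"

definition scheme_C2 ::
  "mesh \<Rightarrow> real set \<Rightarrow> nat \<Rightarrow> (real \<Rightarrow> cell \<Rightarrow> point \<Rightarrow> point \<Rightarrow> real) \<Rightarrow> face_field \<Rightarrow>
   cell_field \<Rightarrow> cell_field \<Rightarrow> bool"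
where
  "scheme_C2 m T k E Eh M B \<longleftrightarrow>
     (\<forall>t\<in>T. \<forall>C\<in>cells m. \<forall>\<psi>\<in>dyQ_space k.
        cell_integral m C (\<lambda>p. ddt T (\<lambda>s. snd (B s C p)) t * \<psi> p)
        + cell_integral m C (\<lambda>p. E t C p (B t C p) * dx \<psi> p)
        - boundary_integral m C (\<lambda>e p. Eh t e p * \<psi> p * fst (normal C e))
        = - cell_integral m C (\<lambda>p. snd (M t C p) * \<psi> p))"

text \<open>
  The integrals of \<open>scheme_F1\<close> to \<open>scheme_C2\<close> exist. Those containing the time derivative
  of \<open>B\<close> are omitted because their integrands are polynomials.
\<close>
definition integrals_defined ::
  "mesh \<Rightarrow> real set \<Rightarrow> nat \<Rightarrow> (real \<Rightarrow> cell \<Rightarrow> point \<Rightarrow> point \<Rightarrow> real) \<Rightarrow> face_field \<Rightarrow>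
   cell_field \<Rightarrow> face_vector_field \<Rightarrow> cell_field \<Rightarrow> bool"
where
  "integrals_defined m T k E Eh M Mh B \<longleftrightarrow>
     (\<forall>t\<in>T. \<forall>(i, j)\<in>cells m. \<forall>e\<in>{VFace i j, VFace (i + 1) j}. \<forall>\<phi>\<in>P_space k.
        face_integrable m e (\<lambda>p. Eh t e p * deriv \<phi> (snd p)) \<and>
        face_integrable m e (\<lambda>p. fst (Mh t e p) * \<phi> (snd p))) \<and>
     (\<forall>t\<in>T. \<forall>(i, j)\<in>cells m. \<forall>e\<in>{HFace i j, HFace i (j + 1)}. \<forall>\<phi>\<in>P_space k.
        face_integrable m e (\<lambda>p. Eh t e p * deriv \<phi> (fst p)) \<and>
        face_integrable m e (\<lambda>p. snd (Mh t e p) * \<phi> (fst p))) \<and>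
     (\<forall>t\<in>T. \<forall>C\<in>cells m. \<forall>\<psi>\<in>dxQ_space k.
        (\<lambda>p. E t C p (B t C p) * dy \<psi> p) integrable_on cell_set m C \<and>
        (\<lambda>p. fst (M t C p) * \<psi> p) integrable_on cell_set m C \<and>
        (\<forall>e\<in>cell_faces C. face_integrable m e (\<lambda>p. Eh t e p * \<psi> p * snd (normal C e)))) \<and>
     (\<forall>t\<in>T. \<forall>C\<in>cells m. \<forall>\<psi>\<in>dyQ_space k.
        (\<lambda>p. E t C p (B t C p) * dx \<psi> p) integrable_on cell_set m C \<and>
        (\<lambda>p. snd (M t C p) * \<psi> p) integrable_on cell_set m C \<and>
        (\<forall>e\<in>cell_faces C. face_integrable m e (\<lambda>p. Eh t e p * \<psi> p * fst (normal C e))))"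

definition dg_solution ::
  "mesh \<Rightarrow> real set \<Rightarrow> nat \<Rightarrow> (real \<Rightarrow> cell \<Rightarrow> point \<Rightarrow> point \<Rightarrow> real) \<Rightarrow> face_field \<Rightarrow>
   vertex_field \<Rightarrow> cell_field \<Rightarrow> face_vector_field \<Rightarrow> cell_field \<Rightarrow> bool"
where
  "dg_solution m T k E Eh Ev M Mh B \<longleftrightarrow>
     admissible_unknown m T k B \<and>
     integrals_defined m T k E Eh M Mh B \<and>
     scheme_F1 m T k Eh Ev Mh B \<and> scheme_F2 m T k Eh Ev Mh B \<and>
     scheme_C1 m T k E Eh M B \<and> scheme_C2 m T k E Eh M B"

definition source_vanishes :: "mesh \<Rightarrow> real set \<Rightarrow> cell_field \<Rightarrow> bool" where
  "source_vanishes m T M \<longleftrightarrow> (\<forall>t\<in>T. \<forall>C\<in>cells m. \<forall>p\<in>cell_set m C. M t C p = 0)"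

text \<open>
  The only part of the consistency of the numerical source that is required: it vanishes
  together with the source.
\<close>
definition source_consistent ::
  "mesh \<Rightarrow> real set \<Rightarrow> cell_field \<Rightarrow> face_vector_field \<Rightarrow> bool"
where
  "source_consistent m T M Mh \<longleftrightarrow>
     (source_vanishes m T M \<longrightarrow>
        (\<forall>t\<in>T. \<forall>(i, j)\<in>cells m.
           (\<forall>e\<in>{VFace i j, VFace (i + 1) j}. \<forall>p\<in>face_set m e. fst (Mh t e p) = 0) \<and>
           (\<forall>e\<in>{HFace i j, HFace i (j + 1)}. \<forall>p\<in>face_set m e. snd (Mh t e p) = 0)))"

end

theory Submission
  imports Defs
begin

text \<open>
  Write \<open>(G, H)\<close> for the time derivative of the discrete field on a cell. It is again a
  Raviart-Thomas field, and its divergence \<open>D = \<partial>\<^sub>x G + \<partial>\<^sub>y H\<close>, which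
  lies in \<open>Q\<^sub>k\<^sub>,\<^sub>k\<close>, is the time derivative of the discrete divergence. Neither fact is
  immediate, since the field is only known to be differentiable in time at each point separately.
  Both follow because a coefficient of a polynomial of bounded degree is a fixed linear combination
  of its values at finitely many points (\<open>bipoly_coefficient_from_point_values\<close>), so that the
  coefficients are differentiable in time as well (\<open>Q_space_time_derivative\<close>).

  The evolution law for the divergence then comes from testing \<open>D\<close> with
  \<open>\<phi> \<in> Q\<^sub>k\<^sub>,\<^sub>k\<close> and integrating by parts on the cell. The volume terms
  \<open>\<integral> G \<partial>\<^sub>x \<phi>\<close> and \<open>\<integral> H \<partial>\<^sub>y \<phi>\<close> are given by the cell
  equations with the test functions \<open>\<partial>\<^sub>x \<phi>\<close> and \<open>\<partial>\<^sub>y \<phi>\<close>, the face terms by the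
  face equations with the traces of \<open>\<phi>\<close>. When the equations are added, every term
  with the electric field disappears: inside the cell because mixed partial derivatives commute, on the faces
  because cell and face equations share the same numerical flux, and at the vertices because the
  tangential differences telescope around the boundary. Only the source terms survive
  (\<open>dg_weak_divergence\<close>).

  If the source vanishes, the law says that \<open>D\<close> is orthogonal to all of
  \<open>Q\<^sub>k\<^sub>,\<^sub>k\<close>. As \<open>D\<close> itself belongs to this space, the integral of \<open>D\<^sup>2\<close> over
  the cell is zero, and so is \<open>D\<close>.
\<close>

section \<open>Recovering coefficients from point values\<close>

definition lagrange_basis :: "real set \<Rightarrow> real \<Rightarrow> real poly" where
  "lagrange_basis A a =
     smult (inverse (\<Prod>b\<in>A - {a}. a - b)) (\<Prod>b\<in>A - {a}. [:- b, 1:])"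

lemma poly_lagrange_basis:
  assumes "finite A" "a \<in> A" "b \<in> A"
  shows "poly (lagrange_basis A a) b = (if a = b then 1 else 0)"
proof (cases "a = b")
  case True
  have "(\<Prod>c\<in>A - {a}. a - c) \<noteq> 0"
    using assms by (auto simp: prod_zero_iff)
  then show ?thesis
    using True by (simp add: lagrange_basis_def poly_prod)
next
  case False
  then have "(\<Prod>c\<in>A - {a}. b - c) = 0"
    using assms by (auto simp: prod_zero_iff)
  then show ?thesis
    using False by (simp add: lagrange_basis_def poly_prod)
qed

lemma degree_lagrange_basis:
  assumes "finite A" "a \<in> A"
  shows "degree (lagrange_basis A a) < card A"
proof -
  have "degree (\<Prod>b\<in>A - {a}. [:- b, 1:]) \<le> (\<Sum>b\<in>A - {a}. degree [:- b, 1 :: real:])"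
    using assms degree_prod_sum_le[of "A - {a}" "\<lambda>b. [:- b, 1:]"] by (simp add: comp_def)
  also have "\<dots> = card (A - {a})" by simp
  also have "\<dots> < card A"
    using assms by (rule card_Diff1_less)
  finally show ?thesis
    unfolding lagrange_basis_def by (meson degree_smult_le le_less_trans)
qed

lemma lagrange_interpolation:
  assumes "finite A" "degree p < card A"
  shows "p = (\<Sum>a\<in>A. smult (poly p a) (lagrange_basis A a))"
proof (rule poly_eqI_degree[where A = A])
  fix b assume b: "b \<in> A"
  have "(\<Sum>a\<in>A. poly p a * poly (lagrange_basis A a) b)
        = (\<Sum>a\<in>A. if a = b then poly p a else 0)"
    using assms(1) b by (intro sum.cong) (auto simp: poly_lagrange_basis)
  then show "poly p b = poly (\<Sum>a\<in>A. smult (poly p a) (lagrange_basis A a)) b"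
    using assms(1) b by (simp add: poly_sum)
next
  show "degree p < card A" by fact
  have "degree (smult (poly p a) (lagrange_basis A a)) \<le> card A - 1" if "a \<in> A" for a
    using degree_lagrange_basis[OF assms(1) that] degree_smult_le[of "poly p a" "lagrange_basis A a"]
    by linarith
  then have "degree (\<Sum>a\<in>A. smult (poly p a) (lagrange_basis A a)) \<le> card A - 1"
    using assms(1) by (intro degree_sum_le) auto
  then show "degree (\<Sum>a\<in>A. smult (poly p a) (lagrange_basis A a)) < card A"
    using assms(2) by linarith
qed

text \<open>
  The weights are the coefficients of the Lagrange basis. They are chosen before the polynomial,
  so that the same weights serve for a polynomial that varies in time.
\<close>
lemma coefficient_from_point_values:
  assumes "finite A" "card A = Suc r"
  shows "\<exists>w. \<forall>c i. i \<le> r \<longrightarrow> c i = (\<Sum>a\<in>A. w i a * (\<Sum>n\<le>r. c n * a ^ n :: real))"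
proof (intro exI allI impI)
  fix c :: "nat \<Rightarrow> real" and i assume i: "i \<le> r"
  define p where "p = (\<Sum>n\<le>r. monom (c n) n)"
  have poly_p: "poly p a = (\<Sum>n\<le>r. c n * a ^ n)" for a
    by (simp add: p_def poly_sum poly_monom)
  have "degree p \<le> r"
    unfolding p_def by (rule degree_sum_le) (auto intro: order.trans[OF degree_monom_le])
  then have "p = (\<Sum>a\<in>A. smult (poly p a) (lagrange_basis A a))"
    using assms by (intro lagrange_interpolation) auto
  then have "coeff p i = (\<Sum>a\<in>A. coeff (lagrange_basis A a) i * poly p a)"
    by (metis (no_types, lifting) coeff_smult coeff_sum mult.commute sum.cong)
  moreover have "coeff p i = c i"
    using i by (simp add: p_def coeff_sum)
  ultimately show "c i = (\<Sum>a\<in>A. coeff (lagrange_basis A a) i * (\<Sum>n\<le>r. c n * a ^ n))"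
    by (simp add: poly_p)
qed

definition bipoly :: "nat \<Rightarrow> nat \<Rightarrow> (nat \<Rightarrow> nat \<Rightarrow> real) \<Rightarrow> point \<Rightarrow> real" where
  "bipoly r s c = (\<lambda>(x, y). \<Sum>i\<le>r. \<Sum>j\<le>s. c i j * x ^ i * y ^ j)"

lemma Q_space_eq_range_bipoly: "Q_space r s = range (bipoly r s)"
  by (auto simp: Q_space_def bipoly_def image_iff)

lemma bipoly_in_Q_space: "bipoly r s c \<in> Q_space r s"
  by (auto simp: Q_space_eq_range_bipoly)

text \<open>
  Tensor product of the one-variable formula: interpolation in \<open>y\<close> along each line
  \<open>x = const\<close> recovers the polynomial in \<open>x\<close> that multiplies \<open>y ^ j\<close>, and
  interpolation in \<open>x\<close> then recovers its coefficients.
\<close>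
lemma bipoly_coefficient_from_point_values:
  assumes "finite X" "card X = Suc r" "finite Y" "card Y = Suc s"
  shows "\<exists>w. \<forall>c i j. i \<le> r \<longrightarrow> j \<le> s \<longrightarrow>
           c i j = (\<Sum>x\<in>X. \<Sum>y\<in>Y. w i j x y * bipoly r s c (x, y))"
proof -
  obtain u where u: "\<And>c i. i \<le> r \<Longrightarrow> c i = (\<Sum>x\<in>X. u i x * (\<Sum>n\<le>r. c n * x ^ n :: real))"
    using coefficient_from_point_values[OF assms(1,2)] by metis
  obtain v where v: "\<And>c j. j \<le> s \<Longrightarrow> c j = (\<Sum>y\<in>Y. v j y * (\<Sum>n\<le>s. c n * y ^ n :: real))"
    using coefficient_from_point_values[OF assms(3,4)] by metis
  have "c i j = (\<Sum>x\<in>X. \<Sum>y\<in>Y. (u i x * v j y) * bipoly r s c (x, y))"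
    if i: "i \<le> r" and j: "j \<le> s" for c i j
  proof -
    have inner: "(\<Sum>n\<le>r. c n j * x ^ n) = (\<Sum>y\<in>Y. v j y * bipoly r s c (x, y))" for x
    proof -
      have "bipoly r s c (x, y) = (\<Sum>l\<le>s. (\<Sum>n\<le>r. c n l * x ^ n) * y ^ l)" for y
        unfolding bipoly_def by (subst sum.swap) (simp add: sum_distrib_right)
      then show ?thesis
        using v[OF j, of "\<lambda>l. \<Sum>n\<le>r. c n l * x ^ n"] by simp
    qed
    have "c i j = (\<Sum>x\<in>X. u i x * (\<Sum>n\<le>r. c n j * x ^ n))"
      using u[OF i, of "\<lambda>n. c n j"] .
    then show ?thesis
      by (simp add: inner sum_distrib_left mult.assoc)
  qed
  then show ?thesis by (intro exI[of _ "\<lambda>i j x y. u i x * v j y"]) blast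
qed

section \<open>Partial derivatives in the tensor product spaces\<close>

lemma bipoly_has_x_derivative:
  "((\<lambda>\<xi>. bipoly r s c (\<xi>, y)) has_real_derivative
     (\<Sum>i\<le>r. \<Sum>j\<le>s. c i j * (real i * x ^ (i - 1)) * y ^ j)) (at x)"
  unfolding bipoly_def by (auto intro!: derivative_eq_intros sum.cong)

lemma dx_bipoly:
  "dx (bipoly r s c) p =
     (\<Sum>i\<le>r. \<Sum>j\<le>s. c i j * (real i * fst p ^ (i - 1)) * snd p ^ j)"
  unfolding dx_def by (rule DERIV_imp_deriv) (rule bipoly_has_x_derivative)

text \<open>
  Exchanging the coordinates turns statements on \<open>dx\<close> into statements on \<open>dy\<close>.
\<close>
lemma dy_eq_dx_swap: "dy f p = dx (f \<circ> prod.swap) (prod.swap p)"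
  by (simp add: dx_def dy_def)

lemma bipoly_swap: "bipoly r s c \<circ> prod.swap = bipoly s r (\<lambda>i j. c j i)"
  by (rule ext, clarsimp simp: bipoly_def, subst sum.swap) (simp add: mult_ac)

lemma Q_space_swap: "f \<in> Q_space r s \<Longrightarrow> f \<circ> prod.swap \<in> Q_space s r"
  unfolding Q_space_eq_range_bipoly by (auto simp: bipoly_swap)

lemma dy_bipoly:
  "dy (bipoly r s c) p =
     (\<Sum>i\<le>r. \<Sum>j\<le>s. c i j * fst p ^ i * (real j * snd p ^ (j - 1)))"
  unfolding dy_eq_dx_swap bipoly_swap dx_bipoly
  by (subst sum.swap) (simp add: mult_ac)

lemma Q_space_has_x_derivative:
  assumes "f \<in> Q_space r s"
  shows "((\<lambda>\<xi>. f (\<xi>, y)) has_real_derivative dx f (x, y)) (at x)"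
  using assms bipoly_has_x_derivative[of r s _ y x]
  unfolding Q_space_eq_range_bipoly by (auto simp: dx_bipoly)

lemma Q_space_continuous: "f \<in> Q_space r s \<Longrightarrow> continuous_on S f"
  unfolding Q_space_def by (auto simp: case_prod_beta intro!: continuous_intros)

lemma Q_space_x_section:
  assumes "f \<in> Q_space r s"
  shows "(\<lambda>x. f (x, y)) \<in> P_space r"
proof -
  obtain c where f: "f = bipoly r s c"
    using assms by (auto simp: Q_space_eq_range_bipoly)
  define p where "p = (\<Sum>i\<le>r. monom (\<Sum>j\<le>s. c i j * y ^ j) i)"
  have "f (x, y) = poly p x" for x
    by (simp add: f bipoly_def p_def poly_sum poly_monom sum_distrib_left
        sum_distrib_right mult_ac)
  moreover have "degree p \<le> r"
    unfolding p_def by (rule degree_sum_le) (auto intro: order.trans[OF degree_monom_le])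
  ultimately show ?thesis unfolding P_space_def by auto
qed

lemma Q_space_y_section:
  "f \<in> Q_space r s \<Longrightarrow> (\<lambda>y. f (x, y)) \<in> P_space s"
  using Q_space_x_section[OF Q_space_swap, of f r s x] by (simp add: comp_def)

lemma dx_Q_space_Suc:
  assumes "f \<in> Q_space (Suc r) s"
  shows "dx f \<in> Q_space r s"
proof -
  obtain c where f: "f = bipoly (Suc r) s c"
    using assms by (auto simp: Q_space_eq_range_bipoly)
  have "dx f = bipoly r s (\<lambda>i j. real (Suc i) * c (Suc i) j)"
    unfolding f
    by (rule ext, unfold dx_bipoly sum.atMost_Suc_shift)
       (simp add: bipoly_def case_prod_beta mult_ac)
  then show ?thesis by (simp add: bipoly_in_Q_space)
qed

lemma dx_Q_space_0: "f \<in> Q_space 0 s \<Longrightarrow> dx f = (\<lambda>p. 0)"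
  unfolding Q_space_eq_range_bipoly by (auto simp: dx_bipoly)

lemma dx_in_dxQ_space: "f \<in> Q_space k k \<Longrightarrow> dx f \<in> dxQ_space k"
  using dx_Q_space_0 dx_Q_space_Suc[of f "k - 1" k] by (cases k) (auto simp: dxQ_space_def)

lemma dy_Q_space_Suc: "f \<in> Q_space r (Suc s) \<Longrightarrow> dy f \<in> Q_space r s"
proof -
  assume "f \<in> Q_space r (Suc s)"
  moreover have "dy f = dx (f \<circ> prod.swap) \<circ> prod.swap"
    by (rule ext) (simp add: dy_eq_dx_swap)
  ultimately show ?thesis
    by (simp add: Q_space_swap dx_Q_space_Suc)
qed

lemma dy_in_dyQ_space: "f \<in> Q_space k k \<Longrightarrow> dy f \<in> dyQ_space k"
proof (cases k)
  case 0
  assume "f \<in> Q_space k k"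
  then have "dy f = (\<lambda>p. 0)"
    using 0 by (intro ext) (simp add: dy_eq_dx_swap dx_Q_space_0[OF Q_space_swap])
  then show ?thesis using 0 by (simp add: dyQ_space_def)
next
  case (Suc n)
  assume "f \<in> Q_space k k"
  then show ?thesis using Suc dy_Q_space_Suc[of f k n] by (simp add: dyQ_space_def)
qed

lemma dx_continuous:
  assumes "f \<in> Q_space r s"
  shows "continuous_on S (dx f)"
proof -
  obtain c where "f = bipoly r s c"
    using assms by (auto simp: Q_space_eq_range_bipoly)
  then have "dx f = (\<lambda>p. \<Sum>i\<le>r. \<Sum>j\<le>s. c i j * (real i * fst p ^ (i - 1)) * snd p ^ j)"
    by (auto simp: dx_bipoly)
  then show ?thesis by (auto intro!: continuous_intros)
qed

lemma dy_dx_eq_dx_dy: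
  assumes "f \<in> Q_space r s"
  shows "dy (dx f) p = dx (dy f) p"
proof -
  obtain c where f: "f = bipoly r s c"
    using assms by (auto simp: Q_space_eq_range_bipoly)
  obtain x y where p: "p = (x, y)" by fastforce
  let ?D = "\<Sum>i\<le>r. \<Sum>j\<le>s. c i j * (real i * x ^ (i - 1)) * (real j * y ^ (j - 1))"
  have "dy (dx f) p = ?D"
    unfolding dy_def p f dx_bipoly
    by (rule DERIV_imp_deriv) (auto intro!: derivative_eq_intros sum.cong)
  moreover have "dx (dy f) p = ?D"
    unfolding dx_def p f dy_bipoly
    by (rule DERIV_imp_deriv) (auto intro!: derivative_eq_intros sum.cong)
  ultimately show ?thesis by simp
qed

lemma Q_space_add: "f \<in> Q_space r s \<Longrightarrow> g \<in> Q_space r s \<Longrightarrow> (\<lambda>p. f p + g p) \<in> Q_space r s"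
proof -
  assume "f \<in> Q_space r s" "g \<in> Q_space r s"
  then obtain c d where "f = bipoly r s c" "g = bipoly r s d"
    by (auto simp: Q_space_eq_range_bipoly)
  then have "(\<lambda>p. f p + g p) = bipoly r s (\<lambda>i j. c i j + d i j)"
    by (auto simp: bipoly_def sum.distrib algebra_simps)
  then show ?thesis by (simp add: bipoly_in_Q_space)
qed

section \<open>Time derivatives of polynomial fields\<close>

text \<open>
  Differentiability in time is required on one rectangle only, as this determines all coefficients;
  the conclusion holds on the whole plane. Differentiating the coefficients also shows that the
  time derivative commutes with the partial derivatives in space.
\<close>
lemma Q_space_time_derivative:
  assumes Q: "\<And>\<tau>. \<tau> \<in> T \<Longrightarrow> f \<tau> \<in> Q_space r s" and t: "t \<in> T"
    and ab: "a < b" and cd: "c < d"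
    and diff: "\<And>p. p \<in> {a..b} \<times> {c..d} \<Longrightarrow> (\<lambda>\<tau>. f \<tau> p) differentiable (at t within T)"
  obtains g where "g \<in> Q_space r s"
    and "\<And>p. ((\<lambda>\<tau>. f \<tau> p) has_real_derivative g p) (at t within T)"
    and "\<And>p. ((\<lambda>\<tau>. dx (f \<tau>) p) has_real_derivative dx g p) (at t within T)"
    and "\<And>p. ((\<lambda>\<tau>. dy (f \<tau>) p) has_real_derivative dy g p) (at t within T)"
proof -
  obtain X where X: "finite X" "card X = Suc r" "X \<subseteq> {a..b}"
    using infinite_arbitrarily_large[OF infinite_Icc[OF ab]] by metis
  obtain Y where Y: "finite Y" "card Y = Suc s" "Y \<subseteq> {c..d}"
    using infinite_arbitrarily_large[OF infinite_Icc[OF cd]] by metis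
  obtain w where w: "\<And>c i j. i \<le> r \<Longrightarrow> j \<le> s \<Longrightarrow>
      c i j = (\<Sum>x\<in>X. \<Sum>y\<in>Y. w i j x y * bipoly r s c (x, y))"
    using bipoly_coefficient_from_point_values[OF X(1,2) Y(1,2)] by metis
  have "\<forall>\<tau>. \<exists>c. \<tau> \<in> T \<longrightarrow> f \<tau> = bipoly r s c"
    using Q unfolding Q_space_eq_range_bipoly by (metis imageE)
  then obtain cf where cf: "\<And>\<tau>. \<tau> \<in> T \<Longrightarrow> f \<tau> = bipoly r s (cf \<tau>)"
    by metis
  have "\<forall>p. \<exists>D. p \<in> {a..b} \<times> {c..d} \<longrightarrow>
      ((\<lambda>\<tau>. f \<tau> p) has_real_derivative D) (at t within T)"
    using diff unfolding real_differentiable_def by blast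
  then obtain D where D: "\<And>p. p \<in> {a..b} \<times> {c..d} \<Longrightarrow>
      ((\<lambda>\<tau>. f \<tau> p) has_real_derivative D p) (at t within T)"
    by metis
  define cf' where "cf' = (\<lambda>i j. \<Sum>x\<in>X. \<Sum>y\<in>Y. w i j x y * D (x, y))"
  have cf': "((\<lambda>\<tau>. cf \<tau> i j) has_real_derivative cf' i j) (at t within T)"
    if "i \<le> r" "j \<le> s" for i j
  proof (rule has_field_derivative_transform_within[OF _ zero_less_one t])
    show "((\<lambda>\<tau>. \<Sum>x\<in>X. \<Sum>y\<in>Y. w i j x y * f \<tau> (x, y)) has_real_derivative cf' i j)
            (at t within T)"
      unfolding cf'_def using X(3) Y(3)
      by (intro DERIV_sum DERIV_cmult D) auto
    show "(\<Sum>x\<in>X. \<Sum>y\<in>Y. w i j x y * f \<tau> (x, y)) = cf \<tau> i j" if "\<tau> \<in> T" for \<tau>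
      using w[of i j "cf \<tau>"] cf[OF that] \<open>i \<le> r\<close> \<open>j \<le> s\<close> by simp
  qed
  show thesis
  proof
    show "bipoly r s cf' \<in> Q_space r s" by (rule bipoly_in_Q_space)
    show "((\<lambda>\<tau>. f \<tau> p) has_real_derivative bipoly r s cf' p) (at t within T)" for p
    proof (rule has_field_derivative_transform_within[OF _ zero_less_one t])
      show "((\<lambda>\<tau>. bipoly r s (cf \<tau>) p) has_real_derivative bipoly r s cf' p) (at t within T)"
        unfolding bipoly_def case_prod_beta by (intro DERIV_sum DERIV_cmult_right cf') auto
    qed (simp add: cf)
    show "((\<lambda>\<tau>. dx (f \<tau>) p) has_real_derivative dx (bipoly r s cf') p) (at t within T)" for p
    proof (rule has_field_derivative_transform_within[OF _ zero_less_one t])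
      show "((\<lambda>\<tau>. dx (bipoly r s (cf \<tau>)) p) has_real_derivative dx (bipoly r s cf') p)
              (at t within T)"
        unfolding dx_bipoly by (intro DERIV_sum DERIV_cmult_right cf') auto
    qed (simp add: cf)
    show "((\<lambda>\<tau>. dy (f \<tau>) p) has_real_derivative dy (bipoly r s cf') p) (at t within T)" for p
    proof (rule has_field_derivative_transform_within[OF _ zero_less_one t])
      show "((\<lambda>\<tau>. dy (bipoly r s (cf \<tau>)) p) has_real_derivative dy (bipoly r s cf') p)
              (at t within T)"
        unfolding dy_bipoly by (intro DERIV_sum DERIV_cmult_right cf') auto
    qed (simp add: cf)
  qed
qed

text \<open>
  Time derivatives are unique because no point of a nondegenerate interval is isolated.
\<close>
lemma at_within_interval_neq_bot:
  fixes T :: "real set"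
  assumes "is_interval T" "interior T \<noteq> {}" "t \<in> T"
  shows "at t within T \<noteq> bot"
proof -
  have "T \<noteq> {x}" for x
    using assms(2) by (metis interior_singleton)
  then have "t islimpt T"
    using assms by (intro connected_imp_perfect) (auto simp: is_interval_connected)
  then show ?thesis by (simp add: trivial_limit_within)
qed

lemma ddt_eqI:
  assumes "is_interval T" "interior T \<noteq> {}" "t \<in> T"
    and "(f has_real_derivative D) (at t within T)"
  shows "ddt T f t = D"
  unfolding ddt_def using assms
  by (intro vector_derivative_within at_within_interval_neq_bot)
     (simp_all add: has_real_derivative_iff_has_vector_derivative)

section \<open>Integration by parts on a cell\<close>

lemma integral_x_derivative_rectangle:
  fixes f g :: "point \<Rightarrow> real"
  assumes "a \<le> b"
    and "\<And>x y. ((\<lambda>\<xi>. f (\<xi>, y)) has_real_derivative g (x, y)) (at x)"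
    and "continuous_on ({a..b} \<times> {c..d}) g"
  shows "integral ({a..b} \<times> {c..d}) g = integral {c..d} (\<lambda>y. f (b, y) - f (a, y))"
proof -
  have cont: "continuous_on (cbox (a, c) (b, d)) (\<lambda>(x, y). g (x, y))"
    using assms(3) by (simp add: cbox_Pair_eq)
  have "integral ({a..b} \<times> {c..d}) g
        = integral {a..b} (\<lambda>x. integral {c..d} (\<lambda>y. g (x, y)))"
    using integral_prod_continuous[of a c b d g] cont by (simp add: cbox_Pair_eq)
  also have "\<dots> = integral {c..d} (\<lambda>y. integral {a..b} (\<lambda>x. g (x, y)))"
    using integral_swap_continuous[of a c b d "\<lambda>x y. g (x, y)"] cont by simp
  also have "\<dots> = integral {c..d} (\<lambda>y. f (b, y) - f (a, y))"
  proof -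
    have "integral {a..b} (\<lambda>x. g (x, y)) = f (b, y) - f (a, y)" for y
      using assms(1,2) by (intro integral_unique fundamental_theorem_of_calculus)
        (auto intro: has_field_derivative_at_within
          simp: has_real_derivative_iff_has_vector_derivative[symmetric])
    then show ?thesis by simp
  qed
  finally show ?thesis .
qed

lemma integral_swap_rectangle:
  fixes g :: "point \<Rightarrow> real"
  assumes "continuous_on ({a..b} \<times> {c..d}) g"
  shows "integral ({a..b} \<times> {c..d}) g = integral ({c..d} \<times> {a..b}) (g \<circ> prod.swap)"
proof -
  have "(\<lambda>(x, y). g (y, x)) = g \<circ> prod.swap" by auto
  then show ?thesis
    using integral_swap_2dim[of a c b d "\<lambda>x y. g (x, y)"] assms by (simp add: cbox_Pair_eq)
qed

lemma rectangle_integration_by_parts_x: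
  assumes "a \<le> b" and f: "f \<in> Q_space r s" and g: "g \<in> Q_space r' s'"
  shows "integral ({a..b} \<times> {c..d}) (\<lambda>p. f p * dx g p)
         = integral {c..d} (\<lambda>y. g (b, y) * f (b, y)) - integral {c..d} (\<lambda>y. g (a, y) * f (a, y))
           - integral ({a..b} \<times> {c..d}) (\<lambda>p. g p * dx f p)"
proof -
  let ?R = "{a..b} \<times> {c..d}"
  note cont = Q_space_continuous[OF f] Q_space_continuous[OF g] dx_continuous[OF f] dx_continuous[OF g]
  have int: "h integrable_on ?R" if "continuous_on ?R h" for h :: "point \<Rightarrow> real"
    using integrable_continuous[of "(a, c)" "(b, d)" h] that by (simp add: cbox_Pair_eq)
  have trace: "continuous_on {c..d} (\<lambda>y. g (x, y) * f (x, y))" for x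
    by (intro continuous_intros continuous_on_compose2[OF Q_space_continuous[OF f, of UNIV]]
        continuous_on_compose2[OF Q_space_continuous[OF g, of UNIV]]) auto
  have "integral ?R (\<lambda>p. f p * dx g p) + integral ?R (\<lambda>p. g p * dx f p)
        = integral ?R (\<lambda>p. f p * dx g p + g p * dx f p)"
    by (intro integral_add[symmetric] int continuous_intros cont)
  also have "\<dots> = integral {c..d} (\<lambda>y. g (b, y) * f (b, y) - g (a, y) * f (a, y))"
  proof (rule integral_x_derivative_rectangle[OF assms(1)])
    show "((\<lambda>\<xi>. g (\<xi>, y) * f (\<xi>, y)) has_real_derivative
            f (x, y) * dx g (x, y) + g (x, y) * dx f (x, y)) (at x)" for x y
      by (rule derivative_eq_intros Q_space_has_x_derivative[OF f] Q_space_has_x_derivative[OF g])+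
         (simp add: mult_ac)
    show "continuous_on ?R (\<lambda>p. f p * dx g p + g p * dx f p)"
      by (intro continuous_intros cont)
  qed
  also have "\<dots> = integral {c..d} (\<lambda>y. g (b, y) * f (b, y))
                  - integral {c..d} (\<lambda>y. g (a, y) * f (a, y))"
    by (intro integral_diff integrable_continuous_interval trace)
  finally show ?thesis by simp
qed

lemma rectangle_integration_by_parts_y:
  assumes "c \<le> d" and f: "f \<in> Q_space r s" and g: "g \<in> Q_space r' s'"
  shows "integral ({a..b} \<times> {c..d}) (\<lambda>p. f p * dy g p)
         = integral {a..b} (\<lambda>x. g (x, d) * f (x, d)) - integral {a..b} (\<lambda>x. g (x, c) * f (x, c))
           - integral ({a..b} \<times> {c..d}) (\<lambda>p. g p * dy f p)"
proof -
  have swap: "integral ({a..b} \<times> {c..d}) (\<lambda>p. u p * dy v p)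
      = integral ({c..d} \<times> {a..b}) (\<lambda>p. (u \<circ> prod.swap) p * dx (v \<circ> prod.swap) p)"
    if u: "u \<in> Q_space i j" and v: "v \<in> Q_space i' j'" for u v i j i' j'
  proof -
    have "continuous_on S (dy v)" for S
      unfolding dy_eq_dx_swap[abs_def]
      by (rule continuous_on_compose2[OF dx_continuous[OF Q_space_swap[OF v], of UNIV]])
         (auto simp: prod.swap_def intro!: continuous_intros)
    then show ?thesis
      by (subst integral_swap_rectangle)
         (auto simp: dy_eq_dx_swap comp_def intro!: continuous_intros Q_space_continuous[OF u])
  qed
  show ?thesis
    unfolding swap[OF f g] swap[OF g f]
    using rectangle_integration_by_parts_x[OF assms(1) Q_space_swap[OF f] Q_space_swap[OF g], of a b]
    by simp
qed

section \<open>The discrete divergence identity\<close>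

lemma boundary_integral_cell:
  "boundary_integral m (i, j) g =
     face_integral m (VFace i j) (g (VFace i j)) + face_integral m (VFace (i + 1) j) (g (VFace (i + 1) j))
     + face_integral m (HFace i j) (g (HFace i j)) + face_integral m (HFace i (j + 1)) (g (HFace i (j + 1)))"
  by (simp add: boundary_integral_def cell_faces_def)

text \<open>
  The polynomials \<open>G\<close> and \<open>H\<close> represent the time derivative of the field on one cell.
  Integration by parts expresses the first integral by the terms that open the four scheme
  equations, and in their sum only the source terms fail to cancel.
\<close>
lemma dg_weak_divergence:
  assumes mesh: "cartesian_mesh m" and dg: "dg_solution m T k E Eh Ev M Mh B"
    and t: "t \<in> T" and C: "(i, j) \<in> cells m"
    and G: "G \<in> Q_space (Suc k) k" "\<And>p. ddt T (\<lambda>s. fst (B s (i, j) p)) t = G p"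
    and H: "H \<in> Q_space k (Suc k)" "\<And>p. ddt T (\<lambda>s. snd (B s (i, j) p)) t = H p"
    and \<phi>: "\<phi> \<in> Q_space k k"
  shows "cell_integral m (i, j) (\<lambda>p. \<phi> p * (dx G p + dy H p))
         - cell_integral m (i, j) (\<lambda>p. M t (i, j) p \<bullet> grad \<phi> p)
         + boundary_integral m (i, j) (\<lambda>e p. \<phi> p * (Mh t e p \<bullet> normal (i, j) e)) = 0"
proof -
  define a b c d where nodes: "a = xnode m i" "b = xnode m (i + 1)"
    "c = ynode m j" "d = ynode m (j + 1)"
  let ?R = "{a..b} \<times> {c..d}"
  have le: "a \<le> b" "c \<le> d"
    using mesh by (auto simp: cartesian_mesh_def nodes strict_mono_less_eq)
  have R: "cell_set m (i, j) = ?R"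
    by (simp add: cell_set_def nodes)
  note [simp] = nodes[symmetric]
  have deriv_x: "deriv (\<lambda>x. \<phi> (x, y)) x = dx \<phi> (x, y)" for x y by (simp add: dx_def)
  have deriv_y: "deriv (\<lambda>y. \<phi> (x, y)) y = dy \<phi> (x, y)" for x y by (simp add: dy_def)

  \<comment> \<open>The traces of \<open>\<phi>\<close> on the faces have degree at most \<open>k\<close>, so they are admissible
     test functions in the face equations.\<close>
  have F1: "integral {c..d} (\<lambda>y. G (xnode m l, y) * \<phi> (xnode m l, y))
        - integral {c..d} (\<lambda>y. Eh t (VFace l j) (xnode m l, y) * dy \<phi> (xnode m l, y))
        + (Ev t (l, j + 1) * \<phi> (xnode m l, d) - Ev t (l, j) * \<phi> (xnode m l, c))
        = - integral {c..d} (\<lambda>y. fst (Mh t (VFace l j) (xnode m l, y)) * \<phi> (xnode m l, y))"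
    if "l = i \<or> l = i + 1" for l
  proof -
    have "\<forall>\<psi>\<in>P_space k.
        face_integral m (VFace l j) (\<lambda>p. ddt T (\<lambda>s. fst (B s (i, j) p)) t * \<psi> (snd p))
        - face_integral m (VFace l j) (\<lambda>p. Eh t (VFace l j) p * deriv \<psi> (snd p))
        + face_diff (VFace l j) (\<lambda>v. Ev t v * \<psi> (ynode m (snd v)))
        = - face_integral m (VFace l j) (\<lambda>p. fst (Mh t (VFace l j) p) * \<psi> (snd p))"
      using dg t C that unfolding dg_solution_def scheme_F1_def by fast
    from bspec[OF this Q_space_y_section[OF \<phi>, of "xnode m l"]] show ?thesis
      by (simp add: G face_integral_def face_diff_def deriv_y)
  qed
  have F2: "integral {a..b} (\<lambda>x. H (x, ynode m l) * \<phi> (x, ynode m l))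
        + integral {a..b} (\<lambda>x. Eh t (HFace i l) (x, ynode m l) * dx \<phi> (x, ynode m l))
        - (Ev t (i + 1, l) * \<phi> (b, ynode m l) - Ev t (i, l) * \<phi> (a, ynode m l))
        = - integral {a..b} (\<lambda>x. snd (Mh t (HFace i l) (x, ynode m l)) * \<phi> (x, ynode m l))"
    if "l = j \<or> l = j + 1" for l
  proof -
    have "\<forall>\<psi>\<in>P_space k.
        face_integral m (HFace i l) (\<lambda>p. ddt T (\<lambda>s. snd (B s (i, j) p)) t * \<psi> (fst p))
        + face_integral m (HFace i l) (\<lambda>p. Eh t (HFace i l) p * deriv \<psi> (fst p))
        - face_diff (HFace i l) (\<lambda>v. Ev t v * \<psi> (xnode m (fst v)))
        = - face_integral m (HFace i l) (\<lambda>p. snd (Mh t (HFace i l) p) * \<psi> (fst p))"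
      using dg t C that unfolding dg_solution_def scheme_F2_def by fast
    from bspec[OF this Q_space_x_section[OF \<phi>, of "ynode m l"]] show ?thesis
      by (simp add: H face_integral_def face_diff_def deriv_x)
  qed

  \<comment> \<open>Testing the cell equations with \<open>dx \<phi>\<close> and \<open>dy \<phi>\<close>. On each face one of the two
     components of the normal vanishes, so the flux terms of one equation live on horizontal faces
     only, those of the other on vertical faces. The order of the mixed derivative is normalised
     to make the two volume terms with \<open>E\<close> opposite.\<close>
  have C1: "integral ?R (\<lambda>p. G p * dx \<phi> p) - integral ?R (\<lambda>p. E t (i, j) p (B t (i, j) p) * dx (dy \<phi>) p)
        - integral {a..b} (\<lambda>x. Eh t (HFace i j) (x, c) * dx \<phi> (x, c))
        + integral {a..b} (\<lambda>x. Eh t (HFace i (j + 1)) (x, d) * dx \<phi> (x, d))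
        = - integral ?R (\<lambda>p. fst (M t (i, j) p) * dx \<phi> p)"
  proof -
    have "\<forall>\<psi>\<in>dxQ_space k.
        cell_integral m (i, j) (\<lambda>p. ddt T (\<lambda>s. fst (B s (i, j) p)) t * \<psi> p)
        - cell_integral m (i, j) (\<lambda>p. E t (i, j) p (B t (i, j) p) * dy \<psi> p)
        + boundary_integral m (i, j) (\<lambda>e p. Eh t e p * \<psi> p * snd (normal (i, j) e))
        = - cell_integral m (i, j) (\<lambda>p. fst (M t (i, j) p) * \<psi> p)"
      using dg t C unfolding dg_solution_def scheme_C1_def by fast
    from bspec[OF this dx_in_dxQ_space[OF \<phi>]] show ?thesis
      by (simp add: G cell_integral_def R boundary_integral_cell face_integral_def normal_def
          dy_dx_eq_dx_dy[OF \<phi>])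
  qed
  have C2: "integral ?R (\<lambda>p. H p * dy \<phi> p) + integral ?R (\<lambda>p. E t (i, j) p (B t (i, j) p) * dx (dy \<phi>) p)
        + integral {c..d} (\<lambda>y. Eh t (VFace i j) (a, y) * dy \<phi> (a, y))
        - integral {c..d} (\<lambda>y. Eh t (VFace (i + 1) j) (b, y) * dy \<phi> (b, y))
        = - integral ?R (\<lambda>p. snd (M t (i, j) p) * dy \<phi> p)"
  proof -
    have "\<forall>\<psi>\<in>dyQ_space k.
        cell_integral m (i, j) (\<lambda>p. ddt T (\<lambda>s. snd (B s (i, j) p)) t * \<psi> p)
        + cell_integral m (i, j) (\<lambda>p. E t (i, j) p (B t (i, j) p) * dx \<psi> p)
        - boundary_integral m (i, j) (\<lambda>e p. Eh t e p * \<psi> p * fst (normal (i, j) e))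
        = - cell_integral m (i, j) (\<lambda>p. snd (M t (i, j) p) * \<psi> p)"
      using dg t C unfolding dg_solution_def scheme_C2_def by fast
    from bspec[OF this dy_in_dyQ_space[OF \<phi>]] show ?thesis
      by (simp add: H cell_integral_def R boundary_integral_cell face_integral_def normal_def)
  qed

  \<comment> \<open>The two summands are integrable because they are the source integrals of the cell
     equations for the test functions \<open>dx \<phi>\<close> and \<open>dy \<phi>\<close>.\<close>
  have M: "integral ?R (\<lambda>p. M t (i, j) p \<bullet> grad \<phi> p)
      = integral ?R (\<lambda>p. fst (M t (i, j) p) * dx \<phi> p) + integral ?R (\<lambda>p. snd (M t (i, j) p) * dy \<phi> p)"
  proof -
    have ints: "\<forall>\<psi>\<in>dxQ_space k. (\<lambda>p. fst (M t (i, j) p) * \<psi> p) integrable_on cell_set m (i, j)"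
      "\<forall>\<psi>\<in>dyQ_space k. (\<lambda>p. snd (M t (i, j) p) * \<psi> p) integrable_on cell_set m (i, j)"
      using dg t C unfolding dg_solution_def integrals_defined_def by fast+
    then show ?thesis
      unfolding grad_def inner_prod_def fst_conv snd_conv inner_real_def
      by (intro integral_add)
        (metis R dx_in_dxQ_space[OF \<phi>], metis R dy_in_dyQ_space[OF \<phi>])
  qed

  have cont: "continuous_on ?R (\<lambda>p. \<phi> p * dx G p)" "continuous_on ?R (\<lambda>p. \<phi> p * dy H p)"
    by (intro continuous_intros Q_space_continuous[OF \<phi>]
        Q_space_continuous[OF dx_Q_space_Suc[OF G(1)]] Q_space_continuous[OF dy_Q_space_Suc[OF H(1)]])+
  have int: "h integrable_on ?R" if "continuous_on ?R h" for h :: "point \<Rightarrow> real"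
    using integrable_continuous[of "(a, c)" "(b, d)" h] that by (simp add: cbox_Pair_eq)
  have "integral ?R (\<lambda>p. \<phi> p * (dx G p + dy H p))
      = integral ?R (\<lambda>p. \<phi> p * dx G p) + integral ?R (\<lambda>p. \<phi> p * dy H p)"
    unfolding distrib_left by (intro integral_add int cont)
  also have "\<dots> = integral {c..d} (\<lambda>y. G (b, y) * \<phi> (b, y)) - integral {c..d} (\<lambda>y. G (a, y) * \<phi> (a, y))
      + integral {a..b} (\<lambda>x. H (x, d) * \<phi> (x, d)) - integral {a..b} (\<lambda>x. H (x, c) * \<phi> (x, c))
      - integral ?R (\<lambda>p. G p * dx \<phi> p) - integral ?R (\<lambda>p. H p * dy \<phi> p)"
    using rectangle_integration_by_parts_x[OF le(1) \<phi> G(1), of c d]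
      rectangle_integration_by_parts_y[OF le(2) \<phi> H(1), of a b] by simp
  moreover have "boundary_integral m (i, j) (\<lambda>e p. \<phi> p * (Mh t e p \<bullet> normal (i, j) e))
      = integral {c..d} (\<lambda>y. fst (Mh t (VFace (i + 1) j) (b, y)) * \<phi> (b, y))
        - integral {c..d} (\<lambda>y. fst (Mh t (VFace i j) (a, y)) * \<phi> (a, y))
        + integral {a..b} (\<lambda>x. snd (Mh t (HFace i (j + 1)) (x, d)) * \<phi> (x, d))
        - integral {a..b} (\<lambda>x. snd (Mh t (HFace i j) (x, c)) * \<phi> (x, c))"
    by (simp add: boundary_integral_cell face_integral_def normal_def inner_prod_def mult.commute)
  ultimately show ?thesis
    using F1[of i] F1[of "i + 1"] F2[of j] F2[of "j + 1"] C1 C2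
    by (simp add: cell_integral_def R M)
qed

lemma boundary_integral_zero:
  assumes "\<And>e p. e \<in> cell_faces C \<Longrightarrow> p \<in> face_set m e \<Longrightarrow> g e p = 0"
  shows "boundary_integral m C g = 0"
  unfolding boundary_integral_def
proof (rule sum.neutral, rule ballI)
  fix e assume e: "e \<in> cell_faces C"
  show "face_integral m e (g e) = 0"
  proof (cases e)
    case (VFace i j)
    then have "integral {ynode m j..ynode m (j + 1)} (\<lambda>y. g e (xnode m i, y)) =
        integral {ynode m j..ynode m (j + 1)} (\<lambda>y. 0)"
      using assms[OF e] by (intro integral_cong) (simp add: face_set_def)
    then show ?thesis using VFace by (simp add: face_integral_def)
  next
    case (HFace i j)
    then have "integral {xnode m i..xnode m (i + 1)} (\<lambda>x. g e (x, ynode m j)) =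
        integral {xnode m i..xnode m (i + 1)} (\<lambda>x. 0)"
      using assms[OF e] by (intro integral_cong) (simp add: face_set_def)
    then show ?thesis using HFace by (simp add: face_integral_def)
  qed
qed

lemma continuous_square_integral_zero:
  fixes f :: "point \<Rightarrow> real"
  assumes "a < b" "c < d" "continuous_on ({a..b} \<times> {c..d}) f"
    and "integral ({a..b} \<times> {c..d}) (\<lambda>p. f p * f p) = 0" and "p \<in> {a..b} \<times> {c..d}"
  shows "f p = 0"
proof -
  let ?l = "(a, c)" and ?u = "(b, d)"
  have cont: "continuous_on (cbox ?l ?u) (\<lambda>p. f p * f p)"
    using assms(3) by (auto simp: cbox_Pair_eq intro: continuous_intros)
  have "((\<lambda>p. f p * f p) has_integral 0) (cbox ?l ?u)"
    using integrable_integral[OF integrable_continuous[OF cont]] assms(4) by (simp add: cbox_Pair_eq)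
  moreover have "box ?l ?u \<noteq> {}"
    using assms(1,2) by (auto simp: box_ne_empty Basis_prod_def)
  ultimately have "f p * f p = 0"
    using assms(5) by (intro has_integral_0_cbox_imp_0[OF cont]) (auto simp: cbox_Pair_eq)
  then show ?thesis by simp
qed

theorem theorem4:
  fixes m :: mesh and T :: "real set" and k :: nat
    and E :: "real \<Rightarrow> cell \<Rightarrow> point \<Rightarrow> point \<Rightarrow> real"
    and Eh :: face_field and Ev :: vertex_field
    and M :: cell_field and Mh :: face_vector_field
    and B :: cell_field
  assumes "cartesian_mesh m"
    and "is_interval T" and "interior T \<noteq> {}"
    and "source_consistent m T M Mh"
    and "dg_solution m T k E Eh Ev M Mh B"
  shows "(source_vanishes m T M \<longrightarrow>
            (\<forall>C\<in>cells m. \<forall>t\<in>T. \<forall>p\<in>cell_set m C.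
               ((\<lambda>s. divergence (B s C) p) has_real_derivative 0) (at t within T))) \<and>
         (\<forall>C\<in>cells m. \<forall>t\<in>T.
            (\<forall>p\<in>cell_set m C. (\<lambda>s. divergence (B s C) p) differentiable (at t within T)) \<and>
            (\<forall>\<phi>\<in>Q_space k k.
               cell_integral m C (\<lambda>p. \<phi> p * ddt T (\<lambda>s. divergence (B s C) p) t)
               - cell_integral m C (\<lambda>p. M t C p \<bullet> grad \<phi> p)
               + boundary_integral m C (\<lambda>e p. \<phi> p * (Mh t e p \<bullet> normal C e)) = 0))"
proof -
  have nodes: "xnode m i < xnode m (i + 1)" "ynode m j < ynode m (j + 1)" for i j
    using assms(1) by (simp_all add: cartesian_mesh_def strict_mono_less)
  \<comment> \<open>The time derivative of the divergence as an element \<open>D\<close> of \<open>Q_space k k\<close>, so that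
     \<open>D\<close> may itself serve as a test function.\<close>
  have main: "\<exists>D\<in>Q_space k k.
      (\<forall>p. ((\<lambda>s. divergence (B s C) p) has_real_derivative D p) (at t within T)) \<and>
      (\<forall>\<phi>\<in>Q_space k k.
         cell_integral m C (\<lambda>p. \<phi> p * D p)
         - cell_integral m C (\<lambda>p. M t C p \<bullet> grad \<phi> p)
         + boundary_integral m C (\<lambda>e p. \<phi> p * (Mh t e p \<bullet> normal C e)) = 0)"
    if C: "C \<in> cells m" and t: "t \<in> T" for C t
  proof -
    obtain i j where ij: "C = (i, j)" by fastforce
    have adm: "admissible_unknown m T k B"
      using assms(5) by (simp add: dg_solution_def)
    have RT: "(\<lambda>p. fst (B s C p)) \<in> Q_space (Suc k) k" "(\<lambda>p. snd (B s C p)) \<in> Q_space k (Suc k)"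
      if "s \<in> T" for s
      using adm that C by (auto simp: admissible_unknown_def RT_space_def)
    have "(\<lambda>s. fst (B s C p)) differentiable (at t within T)"
         "(\<lambda>s. snd (B s C p)) differentiable (at t within T)"
      if "p \<in> {xnode m i..xnode m (i + 1)} \<times> {ynode m j..ynode m (j + 1)}" for p
      using adm C t that unfolding admissible_unknown_def ij cell_set_def differentiable_def
      by (fast intro: has_derivative_fst has_derivative_snd)+
    note diff = this
    obtain G where G: "G \<in> Q_space (Suc k) k"
      "\<And>p. ((\<lambda>s. fst (B s C p)) has_real_derivative G p) (at t within T)"
      "\<And>p. ((\<lambda>s. dx (\<lambda>q. fst (B s C q)) p) has_real_derivative dx G p) (at t within T)"
      using Q_space_time_derivative[OF RT(1) t nodes diff(1)] by metis
    obtain H where H: "H \<in> Q_space k (Suc k)"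
      "\<And>p. ((\<lambda>s. snd (B s C p)) has_real_derivative H p) (at t within T)"
      "\<And>p. ((\<lambda>s. dy (\<lambda>q. snd (B s C q)) p) has_real_derivative dy H p) (at t within T)"
      using Q_space_time_derivative[OF RT(2) t nodes diff(2)] by metis
    note ddt = ddt_eqI[OF assms(2,3) t]
    show ?thesis
    proof (intro bexI[of _ "\<lambda>p. dx G p + dy H p"] conjI allI ballI)
      show "(\<lambda>p. dx G p + dy H p) \<in> Q_space k k"
        by (intro Q_space_add dx_Q_space_Suc dy_Q_space_Suc G H)
      show "((\<lambda>s. divergence (B s C) p) has_real_derivative dx G p + dy H p) (at t within T)" for p
        unfolding divergence_def by (intro DERIV_add G H)
      show "cell_integral m C (\<lambda>p. \<phi> p * (dx G p + dy H p))
         - cell_integral m C (\<lambda>p. M t C p \<bullet> grad \<phi> p)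
         + boundary_integral m C (\<lambda>e p. \<phi> p * (Mh t e p \<bullet> normal C e)) = 0"
        if "\<phi> \<in> Q_space k k" for \<phi>
        using dg_weak_divergence[OF assms(1,5) t, of i j G H \<phi>] C that G(1) H(1)
          ddt[OF G(2)] ddt[OF H(2)] by (simp add: ij)
    qed
  qed
  show ?thesis
  proof (intro conjI impI ballI)
    fix C t p
    assume M0: "source_vanishes m T M" and C: "C \<in> cells m" and t: "t \<in> T" and p: "p \<in> cell_set m C"
    obtain i j where ij: "C = (i, j)" by fastforce
    obtain D where D: "D \<in> Q_space k k"
      "((\<lambda>s. divergence (B s C) p) has_real_derivative D p) (at t within T)"
      and weak: "cell_integral m C (\<lambda>p. D p * D p)
         - cell_integral m C (\<lambda>p. M t C p \<bullet> grad D p)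
         + boundary_integral m C (\<lambda>e p. D p * (Mh t e p \<bullet> normal C e)) = 0"
      using main[OF C t] by blast
    have "cell_integral m C (\<lambda>p. M t C p \<bullet> grad D p) = cell_integral m C (\<lambda>p. 0)"
      using M0 C t unfolding cell_integral_def source_vanishes_def by (intro integral_cong) simp
    moreover have "boundary_integral m C (\<lambda>e p. D p * (Mh t e p \<bullet> normal C e)) = 0"
    proof (rule boundary_integral_zero)
      fix e q assume e: "e \<in> cell_faces C" and q: "q \<in> face_set m e"
      have "(\<forall>e\<in>{VFace i j, VFace (i + 1) j}. \<forall>p\<in>face_set m e. fst (Mh t e p) = 0) \<and>
            (\<forall>e\<in>{HFace i j, HFace i (j + 1)}. \<forall>p\<in>face_set m e. snd (Mh t e p) = 0)"
        using assms(4) M0 C t unfolding source_consistent_def ij by fast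
      with e q show "D q * (Mh t e q \<bullet> normal C e) = 0"
        by (auto simp: ij cell_faces_def normal_def inner_prod_def)
    qed
    ultimately have "cell_integral m C (\<lambda>p. D p * D p) = 0"
      using weak by (simp add: cell_integral_def)
    then have "D p = 0"
      using p unfolding cell_integral_def ij cell_set_def prod.case
      by (intro continuous_square_integral_zero[OF nodes Q_space_continuous[OF D(1)]])
    with D(2) show "((\<lambda>s. divergence (B s C) p) has_real_derivative 0) (at t within T)"
      by simp
  next
    fix C t p assume "C \<in> cells m" "t \<in> T"
    then show "(\<lambda>s. divergence (B s C) p) differentiable at t within T"
      using main[of C t] unfolding real_differentiable_def by blast
  next
    fix C t \<phi> assume C: "C \<in> cells m" and t: "t \<in> T" and \<phi>: "\<phi> \<in> Q_space k k"
    obtain D where D: "\<And>p. ((\<lambda>s. divergence (B s C) p) has_real_derivative D p) (at t within T)"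
      "cell_integral m C (\<lambda>p. \<phi> p * D p)
         - cell_integral m C (\<lambda>p. M t C p \<bullet> grad \<phi> p)
         + boundary_integral m C (\<lambda>e p. \<phi> p * (Mh t e p \<bullet> normal C e)) = 0"
      using main[OF C t] \<phi> by blast
    then show "cell_integral m C (\<lambda>p. \<phi> p * ddt T (\<lambda>s. divergence (B s C) p) t)
         - cell_integral m C (\<lambda>p. M t C p \<bullet> grad \<phi> p)
         + boundary_integral m C (\<lambda>e p. \<phi> p * (Mh t e p \<bullet> normal C e)) = 0"
      by (simp add: ddt_eqI[OF assms(2,3) t D(1)])
  qed
qed

end
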